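(* Let $(X,d)$ be a compact metric space with more than one point, let $Q:X\to(0,\infty)$ be a bounded function, and let $\nu$ be a (variable) Ahlfors $Q$-regular Borel measure on $X$, i.e. there is a constant $C>1$ with $$\tfrac1C\,\nu(B_r(x))\le r^{Q(x)}\le C\,\nu(B_r(x))\qquad\text{for all }x\in X,\ 0<r\le \tfrac{\mathrm{diam}(X)}{2}.$$ Then $Q(x)=\alpha(x)$ for all $x\in X$, where $\alpha$ is the local Hausdorff dimension of $X$, and $\nu\asymp H_{\mathrm{loc}}$, where $H_{\mathrm{loc}}$ is the local Hausdorff measure.
   Context: $B_r(x)=\{y: d(x,y)<r\}$. $|U|$ denotes the diameter of $U$, $\dim(U)$ its Hausdorff dimension. Local Hausdorff dimension: $\alpha(x)=\inf\{\dim(U): U\text{ an open neighborhood of }x\}=\inf_{\epsilon>0}\dim(B_\epsilon(x))\in[0,\infty]$. Local Hausdorff measure: put $\tau(\emptyset)=0$ and $\tau(U)=|U|^{\dim(U)}$ for non-empty $U\subset X$ (convention $|U|^0=1$, also when $|U|=0$). For $A\subset X$ and $\delta>0$ let $\mu^*_{\tau,\delta}(A)=\inf\sum_{U\in\mathscr U}\tau(U)$, the infimum over all at most countable families $\mathscr U$ of subsets of $X$ with $|U|\le\delta$ for $U\in\mathscr U$ and $A\subset\bigcup\mathscr U$; let $\mu^*_\tau(A)=\sup_{\delta>0}\mu^*_{\tau,\delta}(A)$. This is a metric outer measure, and $H_{\mathrm{loc}}$ is its restriction to the Borel sets. Borel measures $\mu,\nu$ are strongly equivalent, $\mu\asymp\nu$,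 if there is $C>0$ with $\frac1C\nu(E)\le\mu(E)\le C\nu(E)$ for every Borel set $E$. *)

theory Defs
  imports "HOL-Analysis.Analysis"
begin

text \<open>
  The power \<open>d\<^sup>s\<close> for a diameter \<open>d \<ge> 0\<close> and an exponent \<open>s \<in> [0,\<infinity>]\<close>, with \<open>d\<^sup>0 = 1\<close> also for
  \<open>d = 0\<close> (unlike \<open>0 powr 0 = 0\<close>). For \<open>s = \<infinity>\<close> it is the limit of \<open>d\<^sup>t\<close> as \<open>t\<close> tends to \<open>\<infinity>\<close>.
\<close>

definition diam_pow :: "real \<Rightarrow> ennreal \<Rightarrow> ennreal" where
  "diam_pow d s =
     (if s = 0 then 1
      else if s = \<infinity> then (if d < 1 then 0 else if d = 1 then 1 else \<infinity>)
      else ennreal (d powr enn2real s))"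

text \<open>
  \<^const>\<open>bounded\<close> is required because \<^const>\<open>diameter\<close> is meaningful only for bounded sets;
  an unbounded set has infinite diameter and is never admissible.
\<close>

definition delta_covers :: "real \<Rightarrow> 'a::metric_space set \<Rightarrow> 'a set set set" where
  "delta_covers \<delta> A =
     {\<U>. countable \<U> \<and> (\<forall>U\<in>\<U>. bounded U \<and> diameter U \<le> \<delta>) \<and> A \<subseteq> \<Union>\<U>}"

definition outer_delta ::
  "('a::metric_space set \<Rightarrow> ennreal) \<Rightarrow> real \<Rightarrow> 'a set \<Rightarrow> ennreal" where
  "outer_delta \<tau> \<delta> A = (INF \<U>\<in>delta_covers \<delta> A. \<Sum>\<^sub>\<infinity>U\<in>\<U>. \<tau> U)"

definition outer_of :: "('a::metric_space set \<Rightarrow> ennreal) \<Rightarrow> 'a set \<Rightarrow> ennreal" where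
  "outer_of \<tau> A = (SUP \<delta>\<in>{0<..}. outer_delta \<tau> \<delta> A)"

definition hausdorff_outer :: "real \<Rightarrow> 'a::metric_space set \<Rightarrow> ennreal" where
  "hausdorff_outer s =
     outer_of (\<lambda>U. if U = {} then 0 else diam_pow (diameter U) (ennreal s))"

definition hausdorff_dim :: "'a::metric_space set \<Rightarrow> ennreal" where
  "hausdorff_dim A = (INF s\<in>{s. 0 \<le> s \<and> hausdorff_outer s A = 0}. ennreal s)"

definition local_dim :: "'a::metric_space \<Rightarrow> ennreal" where
  "local_dim x = (INF U\<in>{U. open U \<and> x \<in> U}. hausdorff_dim U)"

definition local_gauge :: "'a::metric_space set \<Rightarrow> ennreal" where
  "local_gauge U = (if U = {} then 0 else diam_pow (diameter U) (hausdorff_dim U))"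

text \<open>
  Every outer measure obtained from \<^const>\<open>outer_of\<close> is a metric outer measure, hence countably
  additive on the Borel sets, so \<^const>\<open>measure_of\<close> does not fall back to the zero measure here.
\<close>

definition H_loc :: "'a::metric_space measure" where
  "H_loc = measure_of UNIV (sets borel) (outer_of local_gauge)"

definition ahlfors_regular :: "('a::metric_space \<Rightarrow> real) \<Rightarrow> 'a measure \<Rightarrow> bool" where
  "ahlfors_regular Q \<nu> \<longleftrightarrow>
     (\<exists>C>1. \<forall>x r. 0 < r \<and> r \<le> diameter (UNIV :: 'a set) / 2 \<longrightarrow>
        ennreal (1 / C) * emeasure \<nu> (ball x r) \<le> ennreal (r powr Q x) \<and>
        ennreal (r powr Q x) \<le> ennreal C * emeasure \<nu> (ball x r))"

definition strongly_equivalent ::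
  "'a::topological_space measure \<Rightarrow> 'a measure \<Rightarrow> bool" (infix "\<asymp>" 50) where
  "\<mu> \<asymp> \<nu> \<longleftrightarrow>
     (\<exists>C>0. \<forall>E\<in>sets borel.
        ennreal (1 / C) * emeasure \<nu> E \<le> emeasure \<mu> E \<and>
        emeasure \<mu> E \<le> ennreal C * emeasure \<nu> E)"

end

(*
  Comparing balls around two points x, y at distance at most d gives d^Q(x) <= K d^Q(y), so Q is
  log-Hoelder continuous and, on a set U of small diameter, the numbers |U|^s for s between
  inf Q and sup Q over U are all comparable to |U|^Q(x), x in U.  Covering by the balls around a
  maximal r-separated set gives dim U <= sup Q over U, and the mass distribution principle gives
  dim U >= inf Q over U for open U; by continuity, Q is the local dimension.  Consequently
  tau(U) >= |U|^Q(x) / K >= nu(U) / const for every small U, so nu <= const * H_loc, while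
  tau(B_r(x)) <= const * nu(B_(r/2)(x)), so packing a closed set F by disjoint balls of radius r/2
  inside its r-neighbourhood gives H_loc(F) <= const * nu(F).  Inner regularity by closed sets
  extends the last bound to all Borel sets.
*)
theory Submission
  imports Defs
begin

subsection \<open>Countable sums and metric outer measures\<close>

lemma sum_le_infsum_ennreal:
  fixes f :: "'a \<Rightarrow> ennreal"
  assumes "finite F" "F \<subseteq> A"
  shows "sum f F \<le> infsum f A"
  using assms by (subst nonneg_infsum_complete) (auto intro: SUP_upper)

text \<open>The \<open>A i\<close> may overlap, so a finite subset of the union is split by a choice
  \<open>g\<close> of one index for each element; every element is then counted once on the
  left.\<close>

lemma infsum_UN_le_suminf:
  fixes f :: "'a \<Rightarrow> ennreal" and A :: "nat \<Rightarrow> 'a set"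
  shows "infsum f (\<Union>i. A i) \<le> (\<Sum>i. infsum f (A i))"
proof (subst nonneg_infsum_complete, simp, rule SUP_least, clarify)
  fix F assume F: "finite F" "F \<subseteq> (\<Union>i. A i)"
  then obtain g where g: "\<And>x. x \<in> F \<Longrightarrow> x \<in> A (g x)"
    by (metis UN_E subsetD)
  have "sum f F = (\<Sum>i\<in>g ` F. sum f {x \<in> F. g x = i})"
    by (rule sum.image_gen[OF F(1)])
  also have "\<dots> \<le> (\<Sum>i\<in>g ` F. infsum f (A i))"
  proof (intro sum_mono sum_le_infsum_ennreal)
    show "{x \<in> F. g x = i} \<subseteq> A i" for i
      using g by blast
  qed (use F in auto)
  also have "\<dots> \<le> (\<Sum>i. infsum f (A i))"
    using F by (intro sum_le_suminf) auto
  finally show "sum f F \<le> (\<Sum>i. infsum f (A i))" .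
qed

lemma emeasure_UN_le_infsum:
  assumes I: "countable I" and X: "\<And>i. i \<in> I \<Longrightarrow> X i \<in> sets M"
  shows "emeasure M (\<Union>i\<in>I. X i) \<le> (\<Sum>\<^sub>\<infinity>i\<in>I. emeasure M (X i))"
proof -
  let ?J = "to_nat_on I ` I"
  define Y where "Y n = (if n \<in> ?J then X (from_nat_into I n) else {})" for n
  have from_I: "from_nat_into I n \<in> I" if "n \<in> ?J" for n
    using that I by auto
  have Y: "Y n \<in> sets M" for n
    using X from_I by (simp add: Y_def)
  have "(\<Union>i\<in>I. X i) \<subseteq> (\<Union>n. Y n)"
    using I by (force simp: Y_def)
  then have "emeasure M (\<Union>i\<in>I. X i) \<le> emeasure M (\<Union>n. Y n)"
    using Y by (intro emeasure_mono) auto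
  also have "\<dots> \<le> (\<Sum>n. emeasure M (Y n))"
    using Y by (intro emeasure_subadditive_countably) auto
  also have "\<dots> \<le> (\<Sum>\<^sub>\<infinity>i\<in>I. emeasure M (X i))"
  proof (rule suminf_le_const)
    fix n
    have inj: "inj_on (from_nat_into I) ({..<n} \<inter> ?J)"
      using I by (auto simp: inj_on_def)
    have "(\<Sum>i<n. emeasure M (Y i)) = (\<Sum>i\<in>{..<n} \<inter> ?J. emeasure M (X (from_nat_into I i)))"
      by (intro sum.mono_neutral_cong_right) (auto simp: Y_def)
    also have "\<dots> = (\<Sum>i\<in>from_nat_into I ` ({..<n} \<inter> ?J). emeasure M (X i))"
      by (subst sum.reindex[OF inj]) simp
    also have "\<dots> \<le> (\<Sum>\<^sub>\<infinity>i\<in>I. emeasure M (X i))"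
      using from_I by (intro sum_le_infsum_ennreal) auto
    finally show "(\<Sum>i<n. emeasure M (Y i)) \<le> (\<Sum>\<^sub>\<infinity>i\<in>I. emeasure M (X i))" .
  qed simp
  finally show ?thesis .
qed

lemma suminf_ennreal_tail_tendsto_0:
  fixes f :: "nat \<Rightarrow> ennreal"
  assumes "suminf f \<noteq> \<infinity>"
  shows "(\<lambda>n. \<Sum>i. f (i + n)) \<longlonglongrightarrow> 0"
proof -
  have "(\<lambda>n. suminf f - (\<Sum>i<n. f i)) \<longlonglongrightarrow> suminf f - suminf f"
    using assms by (intro tendsto_diff_ennreal tendsto_const summable_LIMSEQ) auto
  moreover have "suminf f - (\<Sum>i<n. f i) = (\<Sum>i. f (i + n))" for n
  proof -
    have "(\<Sum>i<n. f i) \<le> suminf f"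
      by (intro sum_le_suminf) auto
    then have "(\<Sum>i<n. f i) \<noteq> \<infinity>"
      using assms by (metis infinity_ennreal_def top_unique)
    moreover have "suminf f = (\<Sum>i<n. f i) + (\<Sum>i. f (i + n))"
      using suminf_offset[of f n] by (simp add: add.commute)
    ultimately show ?thesis
      by simp
  qed
  ultimately show ?thesis
    using assms by simp
qed

text \<open>
  Caratheodory's criterion. The shells \<open>R n\<close> of points of \<open>A\<close> at distance about \<open>1 / n\<close> from \<open>F\<close>
  are mutually separated when taken with indices of one parity, so their measures sum to at
  most \<open>2 * m A\<close>. Hence the part of \<open>A - F\<close> within distance \<open>1 / n\<close> of \<open>F\<close> has measure tending to \<open>0\<close>.
\<close>

lemma metric_outer_measure_closed:
  fixes m :: "'a::metric_space set \<Rightarrow> ennreal"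
  assumes om: "outer_measure_space (Pow UNIV) m"
    and sep: "\<And>A B e. 0 < e \<Longrightarrow> (\<And>x y. x \<in> A \<Longrightarrow> y \<in> B \<Longrightarrow> e \<le> dist x y) \<Longrightarrow> m A + m B \<le> m (A \<union> B)"
    and F: "closed F"
  shows "F \<in> lambda_system UNIV (Pow UNIV) m"
proof -
  have mono: "m A \<le> m B" if "A \<subseteq> B" for A B
    using om that by (auto simp: outer_measure_space_def increasing_def)
  have pos: "m {} = 0"
    using om by (auto simp: outer_measure_space_def positive_def)
  have csub: "m (\<Union>i. A i) \<le> (\<Sum>i. m (A i))" for A :: "nat \<Rightarrow> 'a set"
  proof -
    \<comment> \<open>\<open>countably_subadditive\<close> speaks of disjoint families only; making
      the family disjoint and monotonicity remove this restriction.\<close>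
    have "m (\<Union>i. A i) = m (\<Union>i. disjointed A i)"
      by (simp add: UN_disjointed_eq)
    also have "\<dots> \<le> (\<Sum>i. m (disjointed A i))"
      using om disjoint_family_disjointed[of A]
      by (auto simp: outer_measure_space_def countably_subadditive_def)
    also have "\<dots> \<le> (\<Sum>i. m (A i))"
      by (intro suminf_le mono disjointed_subset) auto
    finally show ?thesis .
  qed
  have sub: "m (A \<union> B) \<le> m A + m B" for A B
  proof -
    let ?C = "\<lambda>i::nat. if i = 0 then A else if i = 1 then B else {}"
    have "m (A \<union> B) = m (\<Union>i. ?C i)"
      by (rule arg_cong[where f = m]) (auto split: if_splits)
    also have "\<dots> \<le> (\<Sum>i. m (?C i))"
      by (rule csub)
    also have "\<dots> = m A + m B"
      using pos by (subst suminf_finite[of "{0, 1}"]) auto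
    finally show ?thesis .
  qed
  have "m (A \<inter> F) + m (A - F) \<le> m A" for A
  proof (cases "m A = \<infinity>")
    case True
    then show ?thesis by simp
  next
    case fin: False
    define S where "S n = {x \<in> A. \<forall>y\<in>F. inverse (real (Suc n)) \<le> dist x y}" for n
    define R where "R n = S (Suc n) - S n" for n
    have S_sub: "S n \<subseteq> A" for n
      by (auto simp: S_def)
    have S_mono: "S n \<subseteq> S k" if "n \<le> k" for n k
    proof -
      have "inverse (real (Suc k)) \<le> inverse (real (Suc n))"
        using that by (intro le_imp_inverse_le) auto
      then show ?thesis
        unfolding S_def by (blast intro: order_trans)
    qed
    have S_UN: "A - F \<subseteq> (\<Union>n. S n)"
    proof
      fix x assume x: "x \<in> A - F"
      then obtain e where e: "e > 0" "ball x e \<subseteq> - F"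
        using F by (metis Compl_iff DiffD2 openE open_Compl)
      then obtain n where n: "inverse (real (Suc n)) < e"
        using reals_Archimedean by blast
      have "e \<le> dist x y" if "y \<in> F" for y
        using e that by force
      then have "x \<in> S n"
        using x n by (fastforce simp: S_def)
      then show "x \<in> (\<Union>n. S n)" by auto
    qed
    \<comment> \<open>\<open>x\<close> keeps distance \<open>1 / (k + 2)\<close> from
      \<open>F\<close>, while \<open>z\<close> comes within \<open>1 / (j + 1)\<close>, which is at
      most \<open>1 / (k + 3)\<close>, of some point of \<open>F\<close>.\<close>
    have R_sep: "inverse (real (Suc (Suc k))) - inverse (real (Suc (Suc (Suc k)))) \<le> dist x z"
      if "x \<in> R k" "z \<in> R j" "k + 2 \<le> j" for x z k j
    proof -
      have "z \<in> A" "z \<notin> S j"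
        using that S_sub by (auto simp: R_def)
      then obtain y where y: "y \<in> F" "dist z y < inverse (real (Suc j))"
        unfolding S_def by (auto simp: not_le)
      have "inverse (real (Suc (Suc k))) \<le> dist x y"
        using that y unfolding R_def S_def by auto
      moreover have "inverse (real (Suc j)) \<le> inverse (real (Suc (Suc (Suc k))))"
        using that by (intro le_imp_inverse_le) auto
      ultimately show ?thesis
        using y dist_triangle[of x y z] by linarith
    qed
    have gap: "0 < inverse (real (Suc (Suc k))) - inverse (real (Suc (Suc (Suc k))))" for k
      by (simp add: less_imp_inverse_less)
    have alt: "(\<Sum>k<n. m (R (2 * k + p))) \<le> m A" for n p
    proof -
      have "(\<Sum>k<n. m (R (2 * k + p))) \<le> m (\<Union>k<n. R (2 * k + p))"
      proof (induction n)
        case (Suc n)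
        let ?U = "\<Union>k<n. R (2 * k + p)"
        have "m ?U + m (R (2 * n + p)) \<le> m (?U \<union> R (2 * n + p))"
        proof (cases "n = 0")
          case True
          then show ?thesis by (simp add: pos)
        next
          case False
          show ?thesis
          proof (rule sep)
            let ?g = "\<lambda>k. inverse (real (Suc (Suc k))) - inverse (real (Suc (Suc (Suc k))))"
            \<comment> \<open>Only finitely many earlier shells occur, so the least of their gaps is
              still positive.\<close>
            let ?e = "Min ((\<lambda>k. ?g (2 * k + p)) ` {..<n})"
            show "0 < ?e"
              using False gap by (subst Min_gr_iff) auto
            fix x z assume xz: "x \<in> ?U" "z \<in> R (2 * n + p)"
            then obtain k where k: "k < n" "x \<in> R (2 * k + p)" by auto
            have "?e \<le> ?g (2 * k + p)"
              using k by (intro Min_le) auto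
            also have "\<dots> \<le> dist x z"
              using k xz by (intro R_sep) auto
            finally show "?e \<le> dist x z" .
          qed
        qed
        moreover have "(\<Union>k<Suc n. R (2 * k + p)) = ?U \<union> R (2 * n + p)"
          by (auto simp: lessThan_Suc)
        ultimately show ?case
          using Suc by (auto intro: order_trans add_right_mono)
      qed (simp add: pos)
      also have "\<dots> \<le> m A"
        using S_sub by (intro mono) (auto simp: R_def)
      finally show ?thesis .
    qed
    have "(\<Sum>k. m (R k)) \<le> m A + m A"
    proof (rule suminf_le_const)
      fix n
      have "(\<Sum>k<n. m (R k)) \<le> (\<Sum>k<2 * n. m (R k))"
        by (intro sum_mono2) auto
      also have "\<dots> = (\<Sum>k<n. m (R (2 * k + 0))) + (\<Sum>k<n. m (R (2 * k + 1)))"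
        by (induction n) (auto simp: algebra_simps)
      also have "\<dots> \<le> m A + m A"
        by (intro add_mono alt)
      finally show "(\<Sum>k<n. m (R k)) \<le> m A + m A" .
    qed simp
    then have "(\<Sum>k. m (R k)) \<noteq> \<infinity>"
      using fin by (auto simp: top_unique)
    then have tail: "(\<lambda>n. m A + (\<Sum>k. m (R (k + n)))) \<longlonglongrightarrow> m A + 0"
      by (intro tendsto_add tendsto_const suminf_ennreal_tail_tendsto_0)
    have "m (A \<inter> F) + m (A - F) \<le> m A + (\<Sum>k. m (R (k + n)))" for n
    proof -
      have "A - F \<subseteq> S n \<union> (\<Union>k. R (k + n))"
      proof
        fix x assume x: "x \<in> A - F"
        then have ex: "\<exists>k. x \<in> S k"
          using S_UN by auto
        \<comment> \<open>If \<open>x\<close> lies outside \<open>S n\<close>, the first index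
          \<open>l\<close> with \<open>x \<in> S l\<close> exceeds \<open>n\<close> and places
          \<open>x\<close> in the shell \<open>R (l - 1)\<close>.\<close>
        define l where "l = (LEAST k. x \<in> S k)"
        have l: "x \<in> S l" "\<And>k. k < l \<Longrightarrow> x \<notin> S k"
          using ex unfolding l_def by (auto intro: LeastI_ex dest: not_less_Least)
        show "x \<in> S n \<union> (\<Union>k. R (k + n))"
        proof (cases "l \<le> n")
          case True
          then show ?thesis using l S_mono by auto
        next
          case False
          then obtain k where "l = Suc (k + n)"
            by (metis add.commute less_imp_Suc_add not_le)
          then have "x \<in> R (k + n)"
            using l by (auto simp: R_def)
          then show ?thesis by auto
        qed
      qed
      then have "m (A - F) \<le> m (S n \<union> (\<Union>k. R (k + n)))"
        by (rule mono)
      also have "\<dots> \<le> m (S n) + (\<Sum>k. m (R (k + n)))"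
        using sub[of "S n"] csub[of "\<lambda>k. R (k + n)"] by (meson add_left_mono order_trans)
      finally have "m (A \<inter> F) + m (A - F) \<le> (m (A \<inter> F) + m (S n)) + (\<Sum>k. m (R (k + n)))"
        by (simp add: add.assoc add_left_mono)
      also have "m (A \<inter> F) + m (S n) \<le> m (A \<inter> F \<union> S n)"
        by (rule sep[of "inverse (real (Suc n))"]) (auto simp: S_def dist_commute)
      also have "\<dots> \<le> m A"
        using S_sub by (intro mono) auto
      finally show ?thesis
        by (simp add: add_right_mono)
    qed
    then show ?thesis
      using tendsto_lowerbound[OF tail] by auto
  qed
  moreover have "m A \<le> m (A \<inter> F) + m (A - F)" for A
    using sub[of "A \<inter> F" "A - F"] by (simp add: Un_Diff_Int Un_commute)
  ultimately show ?thesis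
    unfolding algebra.lambda_system_eq[OF algebra_Pow] by (auto intro: antisym)
qed

text \<open>The Caratheodory-measurable sets form a sigma-algebra on which \<open>m\<close> is a
  measure; it contains the closed sets and hence all Borel sets.\<close>

lemma countably_additive_metric_outer_measure:
  fixes m :: "'a::metric_space set \<Rightarrow> ennreal"
  assumes om: "outer_measure_space (Pow UNIV) m"
    and sep: "\<And>A B e. 0 < e \<Longrightarrow> (\<And>x y. x \<in> A \<Longrightarrow> y \<in> B \<Longrightarrow> e \<le> dist x y) \<Longrightarrow> m A + m B \<le> m (A \<union> B)"
  shows "countably_additive (sets borel) m"
proof -
  let ?L = "lambda_system UNIV (Pow UNIV) m"
  have L: "measure_space UNIV ?L m"
    using sigma_algebra.caratheodory_lemma[OF sigma_algebra_Pow om] .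
  then have "sigma_sets UNIV (Collect closed) \<subseteq> ?L"
    using metric_outer_measure_closed[OF om sep]
    by (intro sigma_algebra.sigma_sets_subset) (auto simp: measure_space_def)
  then have "sets borel \<subseteq> ?L"
    by (simp add: borel_eq_closed)
  moreover have "countably_additive ?L m"
    using L by (simp add: measure_space_def)
  ultimately show ?thesis
    unfolding countably_additive_def by blast
qed

subsection \<open>The outer measure of a gauge\<close>

lemma outer_delta_mono: "A \<subseteq> B \<Longrightarrow> outer_delta \<tau> \<delta> A \<le> outer_delta \<tau> \<delta> B"
  unfolding outer_delta_def by (intro INF_superset_mono) (auto simp: delta_covers_def)

lemma outer_delta_antimono: "\<delta> \<le> \<delta>' \<Longrightarrow> outer_delta \<tau> \<delta>' A \<le> outer_delta \<tau> \<delta> A"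
  unfolding outer_delta_def by (intro INF_superset_mono) (auto simp: delta_covers_def)

lemma outer_delta_empty [simp]: "outer_delta \<tau> \<delta> {} = 0"
proof -
  have "outer_delta \<tau> \<delta> {} \<le> (\<Sum>\<^sub>\<infinity>U\<in>{}. \<tau> U)"
    unfolding outer_delta_def by (intro INF_lower) (auto simp: delta_covers_def)
  then show ?thesis by simp
qed

text \<open>Near-optimal covers of the \<open>A n\<close>, with errors
  \<open>e / 2 ^ (n + 1)\<close> that sum to \<open>e\<close>, are merged into one cover of the
  union.\<close>

lemma outer_delta_countably_subadditive:
  "outer_delta \<tau> \<delta> (\<Union>i. A i) \<le> (\<Sum>i::nat. outer_delta \<tau> \<delta> (A i))"
proof (rule ennreal_le_epsilon)
  fix e :: real
  assume e: "0 < e" and fin: "(\<Sum>i. outer_delta \<tau> \<delta> (A i)) < top"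
  have "\<exists>\<U>\<in>delta_covers \<delta> (A n). infsum \<tau> \<U> < outer_delta \<tau> \<delta> (A n) + e * (1/2)^Suc n" for n
  proof -
    \<comment> \<open>Finiteness of the total makes every term finite, so that adding a positive
      error gives a strict inequality.\<close>
    have "outer_delta \<tau> \<delta> (A n) < outer_delta \<tau> \<delta> (A n) + e * (1/2)^Suc n"
      using e fin by (auto simp: less_top dest!: ennreal_suminf_lessD)
    then show ?thesis
      unfolding outer_delta_def by (simp only: INF_less_iff)
  qed
  then obtain \<U> where \<U>: "\<And>n. \<U> n \<in> delta_covers \<delta> (A n)"
      and le: "\<And>n. infsum \<tau> (\<U> n) \<le> outer_delta \<tau> \<delta> (A n) + e * (1/2)^Suc n"
    by (metis less_imp_le)
  have "(\<Union>n. \<U> n) \<in> delta_covers \<delta> (\<Union>i. A i)"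
    using \<U> unfolding delta_covers_def by (fastforce intro!: countable_UN)
  then have "outer_delta \<tau> \<delta> (\<Union>i. A i) \<le> infsum \<tau> (\<Union>n. \<U> n)"
    unfolding outer_delta_def by (rule INF_lower)
  also have "\<dots> \<le> (\<Sum>n. infsum \<tau> (\<U> n))"
    by (rule infsum_UN_le_suminf)
  also have "\<dots> \<le> (\<Sum>n. outer_delta \<tau> \<delta> (A n) + e * (1/2)^Suc n)"
    by (intro suminf_le le) auto
  also have "\<dots> = (\<Sum>n. outer_delta \<tau> \<delta> (A n)) + (\<Sum>n. ennreal e * ennreal ((1/2) ^ Suc n))"
    using e by (subst suminf_add[symmetric])
               (auto simp del: ennreal_suminf_cmult simp add: ennreal_mult[symmetric])
  also have "\<dots> = (\<Sum>n. outer_delta \<tau> \<delta> (A n)) + e"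
    unfolding ennreal_suminf_cmult
    by (subst suminf_ennreal_eq[OF zero_le_power power_half_series]) auto
  finally show "outer_delta \<tau> \<delta> (\<Union>i. A i) \<le> (\<Sum>n. outer_delta \<tau> \<delta> (A n)) + e" .
qed

lemma outer_delta_le_outer_of: "0 < \<delta> \<Longrightarrow> outer_delta \<tau> \<delta> A \<le> outer_of \<tau> A"
  unfolding outer_of_def by (intro SUP_upper) auto

lemma outer_of_mono: "A \<subseteq> B \<Longrightarrow> outer_of \<tau> A \<le> outer_of \<tau> B"
  unfolding outer_of_def by (intro SUP_mono) (auto intro: outer_delta_mono)

lemma outer_measure_space_outer_of: "outer_measure_space (Pow UNIV) (outer_of \<tau>)"
proof -
  have "outer_of \<tau> (\<Union>i. A i) \<le> (\<Sum>i::nat. outer_of \<tau> (A i))" for A :: "nat \<Rightarrow> 'a set"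
    unfolding outer_of_def[of _ "\<Union>i. A i"]
  proof (rule SUP_least)
    fix \<delta> :: real assume "\<delta> \<in> {0<..}"
    then show "outer_delta \<tau> \<delta> (\<Union>i. A i) \<le> (\<Sum>i. outer_of \<tau> (A i))"
      using outer_delta_countably_subadditive[of \<tau> \<delta> A]
      by (elim order_trans) (auto intro!: suminf_le outer_delta_le_outer_of)
  qed
  then show ?thesis
    by (auto simp: outer_measure_space_def positive_def increasing_def countably_subadditive_def
        outer_of_mono) (simp add: outer_of_def)
qed

text \<open>A set of diameter below \<open>e\<close> cannot meet both \<open>A\<close> and
  \<open>B\<close>, so a fine cover of the union contains disjoint subfamilies that cover
  \<open>A\<close> and \<open>B\<close>.\<close>

lemma outer_of_separated:
  assumes e: "0 < e" and dist: "\<And>x y. x \<in> A \<Longrightarrow> y \<in> B \<Longrightarrow> e \<le> dist x y"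
  shows "outer_of \<tau> A + outer_of \<tau> B \<le> outer_of \<tau> (A \<union> B)"
proof -
  have small: "outer_delta \<tau> \<delta> A + outer_delta \<tau> \<delta> B \<le> outer_delta \<tau> \<delta> (A \<union> B)" if "\<delta> < e" for \<delta>
    unfolding outer_delta_def[of _ _ "A \<union> B"]
  proof (rule INF_greatest)
    fix \<U> assume \<U>: "\<U> \<in> delta_covers \<delta> (A \<union> B)"
    define \<A> where "\<A> = {U \<in> \<U>. U \<inter> A \<noteq> {}}"
    define \<B> where "\<B> = {U \<in> \<U>. U \<inter> B \<noteq> {}}"
    have "\<A> \<in> delta_covers \<delta> A" "\<B> \<in> delta_covers \<delta> B"
      using \<U> by (fastforce simp: delta_covers_def \<A>_def \<B>_def)+
    then have "outer_delta \<tau> \<delta> A + outer_delta \<tau> \<delta> B \<le> infsum \<tau> \<A> + infsum \<tau> \<B>"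
      unfolding outer_delta_def by (intro add_mono INF_lower)
    also have "\<A> \<inter> \<B> = {}"
    proof (rule ccontr)
      assume "\<A> \<inter> \<B> \<noteq> {}"
      then obtain U x y where U: "U \<in> \<U>" "x \<in> U" "x \<in> A" "y \<in> U" "y \<in> B"
        by (auto simp: \<A>_def \<B>_def)
      then have "dist x y \<le> \<delta>"
        using \<U> diameter_bounded_bound[of U x y] by (force simp: delta_covers_def)
      then show False
        using dist[of x y] U that by auto
    qed
    then have "infsum \<tau> \<A> + infsum \<tau> \<B> = infsum \<tau> (\<A> \<union> \<B>)"
      by (intro infsum_Un_disjoint[symmetric] nonneg_summable_on_complete) auto
    also have "\<dots> \<le> infsum \<tau> \<U>"
      by (intro infsum_mono_neutral nonneg_summable_on_complete) (auto simp: \<A>_def \<B>_def)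
    finally show "outer_delta \<tau> \<delta> A + outer_delta \<tau> \<delta> B \<le> infsum \<tau> \<U>" .
  qed
  have "outer_delta \<tau> a A + outer_delta \<tau> b B \<le> outer_of \<tau> (A \<union> B)" if "0 < a" "0 < b" for a b
  proof -
    \<comment> \<open>The two suprema run over separate scales; both are passed to a common one, and
      \<open>e / 2\<close> keeps it below \<open>e\<close>.\<close>
    let ?d = "min (min a b) (e / 2)"
    have "outer_delta \<tau> a A + outer_delta \<tau> b B \<le> outer_delta \<tau> ?d A + outer_delta \<tau> ?d B"
      by (intro add_mono outer_delta_antimono) auto
    also have "\<dots> \<le> outer_delta \<tau> ?d (A \<union> B)"
      using e by (intro small) auto
    also have "\<dots> \<le> outer_of \<tau> (A \<union> B)"
      using e that by (intro outer_delta_le_outer_of) auto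
    finally show ?thesis .
  qed
  then have "(SUP a\<in>{0<..}. SUP b\<in>{0<..}. outer_delta \<tau> a A + outer_delta \<tau> b B) \<le> outer_of \<tau> (A \<union> B)"
    by (intro SUP_least) auto
  then show ?thesis
    by (simp add: outer_of_def[of _ A] outer_of_def[of _ B] ennreal_SUP_add_left
        ennreal_SUP_add_right[symmetric])
qed

lemma sets_H_loc [simp]: "sets H_loc = sets borel"
  using sets.sigma_sets_eq[of borel] by (simp add: H_loc_def)

lemma emeasure_H_loc:
  assumes "E \<in> sets borel"
  shows "emeasure H_loc E = outer_of local_gauge E"
  unfolding H_loc_def
proof (rule emeasure_measure_of_sigma)
  show "sigma_algebra UNIV (sets borel :: 'a set set)"
    using sets.sigma_algebra_axioms[of borel] by simp
  show "positive (sets borel) (outer_of local_gauge)"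
    using outer_measure_space_outer_of[of local_gauge]
    by (auto simp: outer_measure_space_def positive_def)
  show "countably_additive (sets borel) (outer_of local_gauge)"
    by (intro countably_additive_metric_outer_measure outer_measure_space_outer_of outer_of_separated)
qed fact

subsection \<open>Regularity of finite Borel measures\<close>

text \<open>Closedness makes \<open>F\<close> the intersection of these neighbourhoods, and
  finiteness of \<open>M\<close> gives continuity from above along them.\<close>

lemma Lim_emeasure_neighbourhoods:
  fixes F :: "'a::metric_space set"
  assumes M: "finite_measure M" "sets M = sets borel" and F: "closed F"
  shows "(\<lambda>n. emeasure M (\<Union>x\<in>F. ball x (inverse (real (Suc n))))) \<longlonglongrightarrow> emeasure M F"
proof -
  let ?V = "\<lambda>n. \<Union>x\<in>F. ball x (inverse (real (Suc n)))"
  interpret finite_measure M by fact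
  have "decseq ?V"
  proof (intro decseq_SucI UN_mono subset_ball order_refl)
    show "inverse (real (Suc (Suc n))) \<le> inverse (real (Suc n))" for n
      by (intro le_imp_inverse_le) auto
  qed
  then have "(\<lambda>n. emeasure M (?V n)) \<longlonglongrightarrow> emeasure M (\<Inter>n. ?V n)"
  proof (rule Lim_emeasure_decseq[rotated])
    show "range ?V \<subseteq> sets M"
      using M by (auto intro!: borel_open open_UN)
  qed simp
  also have "(\<Inter>n. ?V n) = F"
  proof (intro equalityI subsetI)
    fix y assume y: "y \<in> (\<Inter>n. ?V n)"
    have "\<exists>x\<in>F. dist x y < e" if "0 < e" for e
    proof -
      obtain n where "inverse (real (Suc n)) < e"
        using \<open>0 < e\<close> reals_Archimedean by blast
      moreover obtain x where "x \<in> F" "dist x y < inverse (real (Suc n))"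
        using y by auto
      ultimately show ?thesis by force
    qed
    then show "y \<in> F"
      using F closed_approachable by blast
  next
    fix y assume "y \<in> F"
    then show "y \<in> (\<Inter>n. ?V n)"
      by (auto intro!: bexI[of _ y])
  qed
  finally show ?thesis .
qed

text \<open>The sets that can be approximated for every \<open>e\<close> form a sigma-algebra
  containing the closed sets. Approximating from both sides at once lets complements go through,
  since they exchange the two sides.\<close>

lemma closed_open_approximation:
  fixes E :: "'a::metric_space set"
  assumes M: "finite_measure M" "sets M = sets borel" and E: "E \<in> sets borel" and e: "0 < e"
  shows "\<exists>F V. closed F \<and> open V \<and> F \<subseteq> E \<and> E \<subseteq> V \<and> measure M (V - F) < e"
proof -
  interpret finite_measure M by fact
  have cl: "A \<in> sets M" if "closed A" for A
    using M that by simp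
  have op: "A \<in> sets M" if "open A" for A
    using M that by simp
  have "E \<in> sigma_sets UNIV (Collect closed)"
    using E by (simp add: borel_eq_closed)
  then show ?thesis
    using e
  proof (induction arbitrary: e)
    case (Basic F)
    then have F: "closed F" by simp
    let ?V = "\<lambda>n. \<Union>x\<in>F. ball x (inverse (real (Suc n)))"
    have "(\<lambda>n. measure M (?V n)) \<longlonglongrightarrow> measure M F"
      using Lim_emeasure_neighbourhoods[OF M F] by (simp add: emeasure_eq_measure)
    then have "\<forall>\<^sub>F n in sequentially. measure M (?V n) < measure M F + e"
      using Basic by (intro order_tendstoD(2)) auto
    then obtain n where n: "measure M (?V n) < measure M F + e"
      by (auto simp: eventually_sequentially)
    have "measure M (?V n - F) = measure M (?V n) - measure M F"
      using F by (intro finite_measure_Diff op cl) auto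
    then have "measure M (?V n - F) < e"
      using n by simp
    moreover have "F \<subseteq> ?V n" by auto
    ultimately show ?case
      using F by (intro exI[of _ F] exI[of _ "?V n"]) auto
  next
    case Empty
    then show ?case by (intro exI[of _ "{}"]) auto
  next
    case (Compl A)
    obtain F V where *: "closed F" "open V" "F \<subseteq> A" "A \<subseteq> V" "measure M (V - F) < e"
      using Compl.IH[OF Compl.prems] by auto
    moreover have "- F - (- V) = V - F" by auto
    ultimately show ?case
      by (intro exI[of _ "- V"] exI[of _ "- F"]) (auto simp: Compl_eq_Diff_UNIV[symmetric])
  next
    case (Union A)
    \<comment> \<open>Half of \<open>e\<close> is spread over the gaps \<open>V i - F i\<close>; the
      other half pays for truncating the union of the closed sets.\<close>
    have "\<exists>F V. closed F \<and> open V \<and> F \<subseteq> A i \<and> A i \<subseteq> V \<and> measure M (V - F) < e / 2 * (1/2) ^ Suc i" for i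
      using Union.prems by (intro Union.IH) auto
    then obtain F V where FV: "\<And>i. closed (F i)" "\<And>i. open (V i)" "\<And>i. F i \<subseteq> A i" "\<And>i. A i \<subseteq> V i"
      and less: "\<And>i. measure M (V i - F i) < e / 2 * (1/2) ^ Suc i"
      by metis
    have sums: "(\<lambda>i. e / 2 * (1/2) ^ Suc i) sums (e / 2 * 1)"
      by (intro sums_mult power_half_series)
    have summable: "summable (\<lambda>i. measure M (V i - F i))"
      using less by (intro summable_comparison_test_ev[OF _ sums_summable[OF sums]])
        (auto intro!: always_eventually less_imp_le)
    have "measure M (\<Union>i. V i - F i) \<le> (\<Sum>i. measure M (V i - F i))"
      using FV summable by (intro finite_measure_subadditive_countably) (auto intro: op cl)
    also have "\<dots> \<le> (\<Sum>i. e / 2 * (1/2) ^ Suc i)"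
      using less by (intro suminf_le summable sums_summable[OF sums]) (auto intro: less_imp_le)
    also have "\<dots> = e / 2"
      using sums by (simp add: sums_iff)
    finally have VF: "measure M (\<Union>i. V i - F i) \<le> e / 2" .
    \<comment> \<open>An infinite union of closed sets need not be closed, so finite unions are
      used; they exhaust it in measure.\<close>
    let ?G = "\<lambda>n. \<Union>i<n. F i"
    have G: "closed (?G n)" for n
      using FV by auto
    have "(\<lambda>n. measure M (?G n)) \<longlonglongrightarrow> measure M (\<Union>n. ?G n)"
      using G cl by (intro finite_Lim_measure_incseq incseq_SucI) (auto simp: lessThan_Suc)
    also have "(\<Union>n. ?G n) = (\<Union>i. F i)" by auto
    finally have "\<forall>\<^sub>F n in sequentially. measure M (\<Union>i. F i) - e / 2 < measure M (?G n)"
      using Union.prems by (intro order_tendstoD(1)) auto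
    then obtain n where n: "measure M (\<Union>i. F i) - e / 2 < measure M (?G n)"
      by (auto simp: eventually_sequentially)
    have UF: "(\<Union>i. F i) \<in> sets M"
      using FV cl by auto
    have VF_sets: "(\<Union>i. V i - F i) \<in> sets M"
      using FV op cl by auto
    have FG_sets: "(\<Union>i. F i) - ?G n \<in> sets M"
      using UF G cl by blast
    have "measure M ((\<Union>i. V i) - ?G n) \<le> measure M ((\<Union>i. V i - F i) \<union> ((\<Union>i. F i) - ?G n))"
      using VF_sets FG_sets by (intro finite_measure_mono) auto
    also have "\<dots> \<le> measure M (\<Union>i. V i - F i) + measure M ((\<Union>i. F i) - ?G n)"
      using VF_sets FG_sets by (intro measure_Un_le)
    also have "measure M ((\<Union>i. F i) - ?G n) = measure M (\<Union>i. F i) - measure M (?G n)"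
      using G UF cl by (intro finite_measure_Diff) auto
    finally have "measure M ((\<Union>i. V i) - ?G n) < e"
      using VF n by simp
    then show ?case
      using FV G by (intro exI[of _ "?G n"] exI[of _ "\<Union>i. V i"]) (auto; blast)
  qed
qed

subsection \<open>Packing and covering bounds\<close>

text \<open>Total boundedness gives a finite \<open>r / 2\<close>-net \<open>K\<close> whose points
  may lie outside \<open>A\<close>. Induction over \<open>K\<close> adds a point of \<open>A\<close>
  near \<open>k\<close> only if the ball around \<open>k\<close> is not yet covered within
  \<open>A\<close>.\<close>

lemma ex_separated_net:
  fixes A :: "'a::metric_space set"
  assumes "compact (UNIV :: 'a set)" and "0 < r"
  obtains N where "N \<subseteq> A" "finite N" "\<forall>x\<in>N. \<forall>y\<in>N. x \<noteq> y \<longrightarrow> r \<le> dist x y"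
    "A \<subseteq> (\<Union>x\<in>N. ball x r)"
proof -
  have "seq_compact (UNIV :: 'a set)"
    using assms by (simp add: compact_eq_seq_compact_metric)
  then obtain K :: "'a set" where K: "finite K" "UNIV \<subseteq> (\<Union>x\<in>K. ball x (r / 2))"
    using seq_compact_imp_totally_bounded[of UNIV] assms by (metis half_gt_zero)
  have "\<exists>N\<subseteq>A. finite N \<and> (\<forall>x\<in>N. \<forall>y\<in>N. x \<noteq> y \<longrightarrow> r \<le> dist x y) \<and>
      A \<inter> (\<Union>x\<in>K. ball x (r / 2)) \<subseteq> (\<Union>x\<in>N. ball x r)"
    using K(1)
  proof induction
    case empty
    then show ?case by auto
  next
    case (insert k K)
    then obtain N where N: "N \<subseteq> A" "finite N" "\<forall>x\<in>N. \<forall>y\<in>N. x \<noteq> y \<longrightarrow> r \<le> dist x y"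
      "A \<inter> (\<Union>x\<in>K. ball x (r / 2)) \<subseteq> (\<Union>x\<in>N. ball x r)"
      by blast
    show ?case
    proof (cases "A \<inter> ball k (r / 2) \<subseteq> (\<Union>x\<in>N. ball x r)")
      case True
      then show ?thesis using N by (intro exI[of _ N]) auto
    next
      case False
      \<comment> \<open>A point \<open>z\<close> missed by the current net is
        \<open>r\<close>-separated from it, and its \<open>r\<close>-ball contains all of
        \<open>ball k (r / 2)\<close>.\<close>
      then obtain z where z: "z \<in> A" "dist k z < r / 2" "\<And>x. x \<in> N \<Longrightarrow> r \<le> dist x z"
        by (force simp: not_less)
      have "ball k (r / 2) \<subseteq> ball z r"
        using z(2) dist_triangle_half_r[of k z r] by (auto simp: subset_iff)
      then show ?thesis
        using N z by (intro exI[of _ "insert z N"]) (auto simp: dist_commute)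
    qed
  qed
  then obtain N where "N \<subseteq> A" "finite N" "\<forall>x\<in>N. \<forall>y\<in>N. x \<noteq> y \<longrightarrow> r \<le> dist x y"
    "A \<inter> (\<Union>x\<in>K. ball x (r / 2)) \<subseteq> (\<Union>x\<in>N. ball x r)"
    by (elim exE conjE)
  moreover have "A \<inter> (\<Union>x\<in>K. ball x (r / 2)) = A"
    using K(2) by auto
  ultimately show thesis
    by (intro that) auto
qed

lemma bounded_diameter_ball:
  fixes x :: "'a::metric_space"
  assumes "0 < r"
  shows "bounded (ball x r) \<and> diameter (ball x r) \<le> 2 * r"
proof -
  have "dist a b \<le> 2 * r" if "a \<in> ball x r" "b \<in> ball x r" for a b
    using that dist_triangle[of a b x] by (simp add: dist_commute)
  then show ?thesis
    using assms by (auto simp: diameter_def intro!: cSUP_least)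
qed

text \<open>For an \<open>r\<close>-separated net in \<open>A\<close>, the balls of radius
  \<open>r\<close> cover \<open>A\<close> while those of radius \<open>r / 2\<close> are disjoint
  and stay inside \<open>V\<close>.\<close>

lemma outer_delta_le_emeasure:
  fixes A :: "'a::metric_space set"
  assumes X: "compact (UNIV :: 'a set)" and M: "sets M = sets borel" and V: "V \<in> sets borel"
    and r: "0 < r" "2 * r \<le> \<delta>" and AV: "(\<Union>x\<in>A. ball x (r / 2)) \<subseteq> V"
    and \<tau>: "\<And>x. x \<in> A \<Longrightarrow> \<tau> (ball x r) \<le> c * emeasure M (ball x (r / 2))"
  shows "outer_delta \<tau> \<delta> A \<le> c * emeasure M V"
proof -
  obtain N where N: "N \<subseteq> A" "finite N"
      "\<forall>x\<in>N. \<forall>y\<in>N. x \<noteq> y \<longrightarrow> r \<le> dist x y"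
      "A \<subseteq> (\<Union>x\<in>N. ball x r)"
    by (rule ex_separated_net[OF X r(1), of A]) (rule that)
  have "(\<lambda>x. ball x r) ` N \<in> delta_covers \<delta> A"
  proof -
    have "countable ((\<lambda>x. ball x r) ` N)"
      using N by (simp add: countable_finite)
    moreover have "\<forall>x\<in>N. diameter (ball x r) \<le> \<delta>"
      using r bounded_diameter_ball[OF r(1)] by (blast intro: order_trans)
    ultimately show ?thesis
      using N unfolding delta_covers_def by simp
  qed
  then have "outer_delta \<tau> \<delta> A \<le> infsum \<tau> ((\<lambda>x. ball x r) ` N)"
    unfolding outer_delta_def by (rule INF_lower)
  also have "\<dots> = sum \<tau> ((\<lambda>x. ball x r) ` N)"
    using N by simp
  \<comment> \<open>Only an inequality, as different centres may have the same ball.\<close>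
  also have "\<dots> \<le> (\<Sum>x\<in>N. \<tau> (ball x r))"
    using sum_image_le[of N \<tau> "\<lambda>x. ball x r"] N by (simp add: comp_def)
  also have "\<dots> \<le> (\<Sum>x\<in>N. c * emeasure M (ball x (r / 2)))"
    using N by (intro sum_mono \<tau>) auto
  also have "\<dots> = c * (\<Sum>x\<in>N. emeasure M (ball x (r / 2)))"
    by (simp add: sum_distrib_left)
  also have "(\<Sum>x\<in>N. emeasure M (ball x (r / 2))) = emeasure M (\<Union>x\<in>N. ball x (r / 2))"
  proof (rule sum_emeasure)
    have "ball x (r / 2) \<inter> ball y (r / 2) = {}" if "x \<in> N" "y \<in> N" "x \<noteq> y" for x y
      using N that disjoint_ballI[of "r / 2" "r / 2" x y] by auto
    then show "disjoint_family_on (\<lambda>x. ball x (r / 2)) N"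
      by (auto simp: disjoint_family_on_def)
  qed (use N M in auto)
  also have "\<dots> \<le> emeasure M V"
    using AV N V M by (intro emeasure_mono) auto
  finally show ?thesis
    by (simp add: mult_left_mono)
qed

text \<open>The mass distribution principle. Covering sets need not be Borel, so each is enlarged to
  a Borel set \<open>W\<close>; for a non-measurable \<open>A\<close> the left side is 0 by
  convention.\<close>

lemma emeasure_le_outer_of:
  fixes A :: "'a::metric_space set"
  assumes M: "sets M = sets borel" and \<delta>: "0 < \<delta>" and c: "0 < c"
    and \<tau>: "\<And>U. bounded U \<Longrightarrow> diameter U \<le> \<delta> \<Longrightarrow> U \<inter> A \<noteq> {} \<Longrightarrow>
      \<exists>W\<in>sets borel. U \<subseteq> W \<and> emeasure M W \<le> ennreal c * \<tau> U"
  shows "emeasure M A \<le> ennreal c * outer_of \<tau> A"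
proof (cases "A \<in> sets M")
  case True
  have "emeasure M A / ennreal c \<le> outer_delta \<tau> \<delta> A"
    unfolding outer_delta_def
  proof (rule INF_greatest)
    fix \<U> assume \<U>: "\<U> \<in> delta_covers \<delta> A"
    define \<V> where "\<V> = {U \<in> \<U>. U \<inter> A \<noteq> {}}"
    have "countable \<V>" "A \<subseteq> \<Union>\<V>"
      using \<U> by (auto simp: \<V>_def delta_covers_def) blast
    have "\<forall>U\<in>\<V>. \<exists>W\<in>sets borel. U \<subseteq> W \<and> emeasure M W \<le> ennreal c * \<tau> U"
      using \<U> \<tau> by (auto simp: \<V>_def delta_covers_def)
    then obtain W where W: "\<And>U. U \<in> \<V> \<Longrightarrow> W U \<in> sets M" "\<And>U. U \<in> \<V> \<Longrightarrow> U \<subseteq> W U"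
      "\<And>U. U \<in> \<V> \<Longrightarrow> emeasure M (W U) \<le> ennreal c * \<tau> U"
      using M by metis
    have "emeasure M A \<le> emeasure M (\<Union>U\<in>\<V>. W U)"
      using \<open>A \<subseteq> \<Union>\<V>\<close> \<open>countable \<V>\<close> W by (intro emeasure_mono sets.countable_UN') fastforce+
    also have "\<dots> \<le> (\<Sum>\<^sub>\<infinity>U\<in>\<V>. emeasure M (W U))"
      using \<open>countable \<V>\<close> W by (intro emeasure_UN_le_infsum) auto
    also have "\<dots> \<le> ennreal c * infsum \<tau> \<U>"
    proof (subst nonneg_infsum_complete, simp, rule SUP_least, clarify)
      fix G assume G: "finite G" "G \<subseteq> \<V>"
      then have "(\<Sum>U\<in>G. emeasure M (W U)) \<le> (\<Sum>U\<in>G. ennreal c * \<tau> U)"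
        using W by (intro sum_mono) auto
      also have "\<dots> = ennreal c * sum \<tau> G"
        by (simp add: sum_distrib_left)
      also have "\<dots> \<le> ennreal c * infsum \<tau> \<U>"
        using G by (intro mult_left_mono sum_le_infsum_ennreal) (auto simp: \<V>_def)
      finally show "(\<Sum>U\<in>G. emeasure M (W U)) \<le> ennreal c * infsum \<tau> \<U>" .
    qed
    finally show "emeasure M A / ennreal c \<le> infsum \<tau> \<U>"
      using c by (intro divide_le_posI_ennreal) auto
  qed
  also have "\<dots> \<le> outer_of \<tau> A"
    using \<delta> by (rule outer_delta_le_outer_of)
  finally have "ennreal c * (emeasure M A / ennreal c) \<le> ennreal c * outer_of \<tau> A"
    by (intro mult_left_mono) auto
  moreover have "ennreal c * (emeasure M A / ennreal c) = emeasure M A"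
    using c by (simp add: ennreal_times_divide mult.commute[of "ennreal c"] mult_divide_eq_ennreal)
  ultimately show ?thesis by simp
qed (simp add: emeasure_notin_sets)

subsection \<open>Variable Ahlfors regularity\<close>

lemma diam_pow_antimono:
  assumes "0 \<le> d" "d \<le> 1" "s \<le> t"
  shows "diam_pow d t \<le> diam_pow d s"
proof (cases "t = \<infinity> \<or> s = 0")
  case True
  then show ?thesis
    using assms by (auto simp: diam_pow_def powr_le_one_le intro: powr_le1)
next
  case False
  then have "s \<noteq> \<infinity>" "t \<noteq> 0"
    using assms by (auto simp: top_unique)
  moreover have "enn2real s \<le> enn2real t"
    using False assms by (intro enn2real_mono) (auto simp: less_top)
  ultimately show ?thesis
    using False assms by (auto simp: diam_pow_def intro!: ennreal_leI powr_mono')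
qed

lemma diam_pow_mono:
  assumes "0 \<le> d" "d \<le> e"
  shows "diam_pow d s \<le> diam_pow e s"
proof -
  have "d powr enn2real s \<le> e powr enn2real s"
    using assms by (intro powr_mono2) auto
  then show ?thesis
    using assms by (auto simp: diam_pow_def ennreal_leI)
qed

lemma diam_pow_ennreal: "0 < d \<Longrightarrow> 0 \<le> s \<Longrightarrow> diam_pow d (ennreal s) = ennreal (d powr s)"
  by (auto simp: diam_pow_def)

text \<open>Equality fails at \<open>d = 0\<close>, \<open>s = 0\<close>, where \<open>powr\<close>
  gives 0 but \<open>diam_pow\<close> gives 1.\<close>

lemma powr_le_diam_pow: "0 \<le> d \<Longrightarrow> 0 \<le> s \<Longrightarrow> ennreal (d powr s) \<le> diam_pow d (ennreal s)"
  by (cases "d = 0") (auto simp: diam_pow_ennreal)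

text \<open>Shifting an exponent by \<open>log \<delta> K\<close> costs exactly a factor
  \<open>K\<close>; this turns bounds on the variation of \<open>Q\<close> at scale
  \<open>\<delta>\<close> into multiplicative constants.\<close>

lemma powr_minus_log:
  fixes \<delta> :: real
  assumes "0 < \<delta>" "\<delta> < 1" "0 < K"
  shows "\<delta> powr (a - log \<delta> K) = \<delta> powr a / K" "\<delta> powr (a + log \<delta> K) = K * \<delta> powr a"
  using assms by (simp_all add: powr_diff powr_add)

section \<open>Standing assumptions and logarithmic Hoelder continuity of \<open>Q\<close>\<close>

locale ahlfors_space =
  fixes Q :: "'a::metric_space \<Rightarrow> real" and \<nu> :: "'a measure" and C M D :: real
  assumes compact: "compact (UNIV :: 'a set)"
    and D: "D = diameter (UNIV :: 'a set)" and diam_pos: "0 < D"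
    and Q_pos: "0 < Q x" and Q_le: "Q x \<le> M"
    and sets_nu: "sets \<nu> = sets borel"
    and C: "1 < C"
    and ball_upper: "0 < r \<Longrightarrow> r \<le> D / 2 \<Longrightarrow>
      emeasure \<nu> (ball x r) \<le> ennreal (C * r powr Q x)"
    and ball_lower: "0 < r \<Longrightarrow> r \<le> D / 2 \<Longrightarrow>
      ennreal (r powr Q x) \<le> ennreal C * emeasure \<nu> (ball x r)"
begin

text \<open>One factor \<open>C\<close> for each of the two ball estimates and
  \<open>2 powr M\<close> for doubling a radius.\<close>

definition "K = C * C * 2 powr M"

lemma M_pos: "0 < M"
  using Q_pos Q_le by (meson less_le_trans)

lemma K_gt_1: "1 < K"
proof -
  have "1 < C * C"
    using C by (metis less_1_mult)
  moreover have "1 \<le> 2 powr M"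
    using M_pos by (intro ge_one_powr_ge_zero) auto
  ultimately show ?thesis
    unfolding K_def by (metis less_le_trans mult.right_neutral mult_left_mono not_less order.strict_trans1 zero_less_one less_imp_le)
qed

text \<open>By compactness, finitely many balls of the largest admissible radius
  \<open>D / 2\<close> cover the space.\<close>

lemma finite_nu: "finite_measure \<nu>"
proof (rule finite_measureI)
  have r: "0 < D / 2" using diam_pos by simp
  obtain N :: "'a set" where N: "finite N" "UNIV \<subseteq> (\<Union>x\<in>N. ball x (D / 2))"
    by (rule ex_separated_net[OF compact r, of UNIV]) (rule that)
  have "space \<nu> = UNIV"
    using sets_nu by (metis sets_eq_imp_space_eq space_borel)
  then have "emeasure \<nu> (space \<nu>) \<le> emeasure \<nu> (\<Union>x\<in>N. ball x (D / 2))"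
    using N sets_nu by (intro emeasure_mono) auto
  also have "\<dots> \<le> (\<Sum>x\<in>N. emeasure \<nu> (ball x (D / 2)))"
    using N sets_nu by (intro emeasure_subadditive_finite) auto
  also have "\<dots> \<le> (\<Sum>x\<in>N. ennreal (C * (D / 2) powr Q x))"
    using r by (intro sum_mono ball_upper) auto
  also have "\<dots> < \<infinity>"
    using N by (simp add: less_top)
  finally show "emeasure \<nu> (space \<nu>) \<noteq> \<infinity>" by simp
qed

text \<open>
  Doubling the radius of the ball around \<open>y\<close> costs at most the factor \<open>2 powr M\<close>; this is
  logarithmic Hoelder continuity of \<open>Q\<close> in multiplicative form.
\<close>

lemma powr_compare:
  assumes "dist x y \<le> \<delta>" "0 < \<delta>" "\<delta> \<le> D / 4"
  shows "\<delta> powr Q x \<le> K * \<delta> powr Q y"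
proof -
  have "ball x \<delta> \<subseteq> ball y (2 * \<delta>)"
    using assms(1) by (auto simp: dist_commute) (smt (verit) dist_triangle dist_commute)
  have "ennreal (\<delta> powr Q x) \<le> ennreal C * emeasure \<nu> (ball x \<delta>)"
    using assms diam_pos by (intro ball_lower) auto
  also have "\<dots> \<le> ennreal C * emeasure \<nu> (ball y (2 * \<delta>))"
    using \<open>ball x \<delta> \<subseteq> ball y (2 * \<delta>)\<close> sets_nu by (intro mult_left_mono emeasure_mono) auto
  \<comment> \<open>The assumption \<open>\<delta> \<le> D / 4\<close> keeps the doubled radius
    within the range of the ball estimates.\<close>
  also have "\<dots> \<le> ennreal C * ennreal (C * (2 * \<delta>) powr Q y)"
    using assms by (intro mult_left_mono ball_upper) auto
  also have "\<dots> = ennreal (C * C * 2 powr Q y * \<delta> powr Q y)"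
    using C assms by (simp add: ennreal_mult[symmetric] powr_mult mult_ac)
  also have "\<dots> \<le> ennreal (K * \<delta> powr Q y)"
    unfolding K_def using C Q_le[of y] by (intro ennreal_leI mult_right_mono mult_left_mono powr_mono) auto
  finally show ?thesis
    using K_gt_1 by simp
qed

text \<open>Logarithm of \<open>powr_compare\<close>, divided by the negative
  \<open>ln \<delta>\<close>. The error \<open>- log \<delta> K\<close> is positive and tends to 0
  with \<open>\<delta>\<close>.\<close>

lemma Q_compare:
  assumes "dist x y \<le> \<delta>" "0 < \<delta>" "\<delta> \<le> D / 4" "\<delta> < 1"
  shows "Q y \<le> Q x - log \<delta> K"
proof -
  have "ln (\<delta> powr Q x) \<le> ln (K * \<delta> powr Q y)"
    using powr_compare[OF assms(1-3)] assms K_gt_1 by (subst ln_le_cancel_iff) auto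
  then have "Q x * ln \<delta> \<le> ln K + Q y * ln \<delta>"
    using assms K_gt_1 by (simp add: ln_mult ln_powr)
  moreover have "ln \<delta> < 0"
    using assms by simp
  ultimately show ?thesis
    by (simp add: log_def field_simps)
qed

lemma isCont_Q: "isCont Q x"
  unfolding continuous_at_eps_delta
proof (intro allI impI)
  fix e :: real assume e: "0 < e"
  \<comment> \<open>The second bound is chosen to make the error \<open>- log \<delta> K\<close> at
    most \<open>e / 2\<close>.\<close>
  define \<delta> where "\<delta> = min (D / 4) (K powr (- (2 / e)))"
  have "K powr (- (2 / e)) < 1"
    using K_gt_1 e by (simp add: powr_minus_divide)
  then have \<delta>: "0 < \<delta>" "\<delta> \<le> D / 4" "\<delta> < 1"
    using diam_pos K_gt_1 by (auto simp: \<delta>_def)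
  have "ln \<delta> \<le> ln (K powr (- (2 / e)))"
    using \<delta> K_gt_1 by (subst ln_le_cancel_iff) (auto simp: \<delta>_def)
  then have "ln \<delta> \<le> - (2 / e) * ln K"
    using K_gt_1 by (simp add: ln_powr)
  then have "- log \<delta> K \<le> e / 2"
    using \<delta> e by (simp add: log_def field_simps)
  then have "\<bar>Q y - Q x\<bar> < e" if "dist y x < \<delta>" for y
    using Q_compare[of x y \<delta>] Q_compare[of y x \<delta>] \<delta> that e by (auto simp: dist_commute)
  then show "\<exists>d>0. \<forall>y. dist y x < d \<longrightarrow> dist (Q y) (Q x) < e"
    using \<delta> by (auto simp: dist_real_def)
qed

section \<open>Hausdorff dimension of sets and the local dimension\<close>

lemma open_nu_pos:
  assumes "open B" "x \<in> B"
  shows "0 < emeasure \<nu> B"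
proof -
  obtain e where e: "0 < e" "ball x e \<subseteq> B"
    using assms openE by blast
  define r where "r = min e (D / 2)"
  have r: "0 < r" "r \<le> D / 2" "r \<le> e"
    using e diam_pos by (auto simp: r_def)
  have "0 < ennreal (r powr Q x)"
    using r by simp
  also have "\<dots> \<le> ennreal C * emeasure \<nu> (ball x r)"
    using r by (intro ball_lower)
  finally have "0 < emeasure \<nu> (ball x r)"
    by (metis gr_zeroI less_irrefl mult_zero_right)
  also have "\<dots> \<le> emeasure \<nu> B"
    using e r assms sets_nu by (intro emeasure_mono) (auto intro: subsetD[OF e(2)])
  finally show ?thesis .
qed

text \<open>With exponent \<open>t = s + e\<close> the packing bound carries a surplus factor
  \<open>(r / 2) powr e\<close>, which tends to 0 while the total mass stays finite; so the outer
  measure of exponent \<open>t\<close> vanishes.\<close>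

lemma hausdorff_dim_le:
  assumes s: "0 \<le> s" and Q: "\<And>x. x \<in> A \<Longrightarrow> Q x \<le> s"
  shows "hausdorff_dim A \<le> ennreal s"
proof (rule ennreal_le_epsilon)
  fix e :: real assume e: "0 < e"
  define t where "t = s + e"
  let ?\<tau> = "\<lambda>U :: 'a set. if U = {} then 0 else diam_pow (diameter U) (ennreal t)"
  \<comment> \<open>\<open>4 powr t\<close> comes from \<open>2 * r = 4 * (r / 2)\<close>,
    \<open>C\<close> from the lower ball estimate at radius \<open>r / 2\<close>.\<close>
  let ?c = "\<lambda>r. 4 powr t * (r / 2) powr e * C"
  interpret finite_measure \<nu> by (rule finite_nu)
  have "outer_delta ?\<tau> \<delta> A \<le> ennreal (?c r * measure \<nu> UNIV)"
    if r: "0 < r" "2 * r \<le> \<delta>" "r \<le> D" "r \<le> 1" for \<delta> r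
  proof -
    have "?\<tau> (ball x r) \<le> ennreal (?c r) * emeasure \<nu> (ball x (r / 2))" if "x \<in> A" for x
    proof -
      have "?\<tau> (ball x r) \<le> diam_pow (2 * r) (ennreal t)"
        using bounded_diameter_ball[OF r(1), of x] r
        by (auto intro!: diam_pow_mono diameter_ge_0)
      also have "\<dots> = ennreal ((2 * r) powr t)"
        using r s e by (intro diam_pow_ennreal) (auto simp: t_def)
      also have "(2 * r) powr t = 4 powr t * (r / 2) powr e * (r / 2) powr s"
        using r powr_mult[of 4 "r / 2" t] by (simp add: t_def powr_add)
      \<comment> \<open>The base \<open>r / 2\<close> is below 1, so the smaller exponent
        \<open>Q x\<close> gives the larger power.\<close>
      also have "\<dots> \<le> 4 powr t * (r / 2) powr e * (r / 2) powr Q x"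
        using r Q[OF that] by (intro mult_left_mono powr_mono') auto
      also have "ennreal \<dots> = ennreal (4 powr t * (r / 2) powr e) * ennreal ((r / 2) powr Q x)"
        by (rule ennreal_mult) auto
      also have "\<dots> \<le> ennreal (4 powr t * (r / 2) powr e) * (ennreal C * emeasure \<nu> (ball x (r / 2)))"
        using r by (intro mult_left_mono ball_lower) auto
      also have "\<dots> = ennreal (?c r) * emeasure \<nu> (ball x (r / 2))"
        using C by (simp add: ennreal_mult mult.assoc)
      finally show ?thesis by (simp add: ennreal_leI)
    qed
    then have "outer_delta ?\<tau> \<delta> A \<le> ennreal (?c r) * emeasure \<nu> UNIV"
      using r compact sets_nu by (intro outer_delta_le_emeasure[where r = r]) auto
    then show ?thesis
      using C by (simp add: emeasure_eq_measure ennreal_mult)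
  qed note le = this
  have "outer_delta ?\<tau> \<delta> A \<le> 0" if "0 < \<delta>" for \<delta>
  proof (rule tendsto_lowerbound)
    have "((\<lambda>r. r / 2) \<longlongrightarrow> 0 / 2) (at_right (0 :: real))"
      by (intro tendsto_intros) auto
    then have "((\<lambda>r. (r / 2) powr e) \<longlongrightarrow> 0) (at_right (0 :: real))"
      using e by (intro tendsto_zero_powrI tendsto_const)
        (auto simp: eventually_at_right_less intro!: eventually_at_rightI[of 0 1])
    then have "((\<lambda>r. ?c r * measure \<nu> UNIV) \<longlongrightarrow> 4 powr t * 0 * C * measure \<nu> UNIV) (at_right 0)"
      by (intro tendsto_intros)
    then show "((\<lambda>r. ennreal (?c r * measure \<nu> UNIV)) \<longlongrightarrow> 0) (at_right 0)"
      using tendsto_ennrealI by fastforce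
    show "\<forall>\<^sub>F r in at_right 0. outer_delta ?\<tau> \<delta> A \<le> ennreal (?c r * measure \<nu> UNIV)"
      using \<open>0 < \<delta>\<close> diam_pos
      by (intro eventually_at_rightI[of 0 "min (\<delta> / 2) (min D 1)"] le) auto
  qed simp
  then have "hausdorff_outer t A = 0"
    by (simp add: hausdorff_outer_def outer_of_def)
  then have "hausdorff_dim A \<le> ennreal t"
    unfolding hausdorff_dim_def using s e by (intro INF_lower) (auto simp: t_def)
  then show "hausdorff_dim A \<le> ennreal s + ennreal e"
    using s e by (simp add: t_def)
qed

text \<open>\<open>U\<close> lies in a ball around \<open>x\<close> whose radius is comparable to
  its diameter. For diameter 0 no such ball exists; then \<open>{x}\<close> serves, a null set
  because the measures of its balls tend to 0.\<close>

lemma small_set_nu: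
  assumes U: "bounded U" "x \<in> U" "diameter U \<le> D / 4"
  shows "\<exists>W\<in>sets borel. U \<subseteq> W \<and> emeasure \<nu> W \<le> ennreal (C * 2 powr M * diameter U powr Q x)"
proof (cases "diameter U = 0")
  case True
  have "U \<subseteq> {x}"
    using U diameter_bounded_bound[of U x] True by fastforce
  moreover have "emeasure \<nu> {x} \<le> 0"
  proof (rule tendsto_lowerbound)
    have "((\<lambda>r. r powr Q x) \<longlongrightarrow> 0) (at_right (0 :: real))"
      using Q_pos by (intro tendsto_zero_powrI[OF _ tendsto_const])
        (auto intro!: eventually_at_rightI[of 0 1] tendsto_intros)
    then have "((\<lambda>r. C * r powr Q x) \<longlongrightarrow> C * 0) (at_right 0)"
      by (intro tendsto_intros)
    then show "((\<lambda>r. ennreal (C * r powr Q x)) \<longlongrightarrow> 0) (at_right 0)"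
      using tendsto_ennrealI by fastforce
    have "emeasure \<nu> {x} \<le> ennreal (C * r powr Q x)" if "0 < r" "r < D / 2" for r
    proof -
      have "emeasure \<nu> {x} \<le> emeasure \<nu> (ball x r)"
        using that sets_nu by (intro emeasure_mono) auto
      also have "\<dots> \<le> ennreal (C * r powr Q x)"
        using that by (intro ball_upper) auto
      finally show ?thesis .
    qed
    then show "\<forall>\<^sub>F r in at_right 0. emeasure \<nu> {x} \<le> ennreal (C * r powr Q x)"
      using diam_pos by (intro eventually_at_rightI[of 0 "D / 2"]) auto
  qed simp
  ultimately show ?thesis
    by (intro bexI[of _ "{x}"]) auto
next
  case False
  let ?d = "diameter U"
  have d: "0 < ?d"
    using False diameter_ge_0[OF U(1)] by simp
  \<comment> \<open>The factor 2 captures points at distance exactly \<open>?d\<close> in an open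
    ball.\<close>
  have "U \<subseteq> ball x (2 * ?d)"
    using U diameter_bounded_bound[of U x] d by fastforce
  moreover have "emeasure \<nu> (ball x (2 * ?d)) \<le> ennreal (C * (2 * ?d) powr Q x)"
    using d U by (intro ball_upper) auto
  moreover have "C * (2 * ?d) powr Q x \<le> C * 2 powr M * ?d powr Q x"
    using C Q_le[of x] d by (simp add: powr_mult powr_mono)
  ultimately show ?thesis
    by (intro bexI[of _ "ball x (2 * ?d)"]) (auto intro: order_trans ennreal_leI)
qed

text \<open>If \<open>V\<close> were a null set for an exponent \<open>t < s\<close>, the mass
  distribution principle would give the non-empty open set \<open>B\<close> measure 0.\<close>

lemma hausdorff_dim_ge:
  assumes B: "open B" "x \<in> B" "B \<subseteq> V" and Q: "\<And>y. y \<in> B \<Longrightarrow> s \<le> Q y"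
  shows "ennreal s \<le> hausdorff_dim V"
  unfolding hausdorff_dim_def
proof (rule INF_greatest)
  fix t assume "t \<in> {t. 0 \<le> t \<and> hausdorff_outer t V = 0}"
  then have t: "0 \<le> t" "hausdorff_outer t V = 0" by auto
  have False if "t < s"
  proof -
    let ?\<tau> = "\<lambda>U :: 'a set. if U = {} then 0 else diam_pow (diameter U) (ennreal t)"
    have "emeasure \<nu> B \<le> ennreal (C * 2 powr M) * outer_of ?\<tau> B"
    proof (rule emeasure_le_outer_of[OF sets_nu])
      show "0 < min (D / 4) 1" using diam_pos by simp
      fix U :: "'a set" assume U: "bounded U" "diameter U \<le> min (D / 4) 1" "U \<inter> B \<noteq> {}"
      then obtain y where y: "y \<in> U" "y \<in> B" by auto
      obtain W where W: "W \<in> sets borel" "U \<subseteq> W"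
        "emeasure \<nu> W \<le> ennreal (C * 2 powr M * diameter U powr Q y)"
        using small_set_nu[of U y] U y by auto
      \<comment> \<open>Diameters are at most 1 here, so lowering the exponent from
        \<open>Q y\<close> to \<open>t\<close> enlarges the power.\<close>
      have "diameter U powr Q y \<le> diameter U powr t"
        using U Q[OF y(2)] \<open>t < s\<close> diameter_ge_0[OF U(1)] by (intro powr_mono') auto
      then have "ennreal (C * 2 powr M * diameter U powr Q y)
          \<le> ennreal (C * 2 powr M) * ennreal (diameter U powr t)"
        using C by (simp add: ennreal_mult[symmetric])
      also have "\<dots> \<le> ennreal (C * 2 powr M) * ?\<tau> U"
        using y t diameter_ge_0[OF U(1)] by (auto intro!: mult_left_mono powr_le_diam_pow)
      finally show "\<exists>W\<in>sets borel. U \<subseteq> W \<and> emeasure \<nu> W \<le> ennreal (C * 2 powr M) * ?\<tau> U"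
        using W by (blast intro: order_trans)
    qed (use C in auto)
    also have "\<dots> \<le> ennreal (C * 2 powr M) * outer_of ?\<tau> V"
      using B by (intro mult_left_mono outer_of_mono) auto
    also have "\<dots> = 0"
      using t by (simp add: hausdorff_outer_def)
    finally show False
      using open_nu_pos[OF B(1,2)] by simp
  qed
  then show "ennreal s \<le> ennreal t"
    by (intro ennreal_leI) force
qed

text \<open>For the upper bound one small ball suffices; the lower bound must hold for every
  neighbourhood \<open>V\<close>, and is found on the part of \<open>V\<close> near
  \<open>x\<close>, where continuity controls \<open>Q\<close>.\<close>

lemma local_dim_eq: "local_dim x = ennreal (Q x)"
proof (rule antisym)
  have near: "\<exists>d>0. \<forall>y. dist y x < d \<longrightarrow> \<bar>Q y - Q x\<bar> < e" if "0 < e" for e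
    using isCont_Q[of x] that unfolding continuous_at_eps_delta by (auto simp: dist_real_def)
  show "local_dim x \<le> ennreal (Q x)"
  proof (rule ennreal_le_epsilon)
    fix e :: real assume e: "0 < e"
    obtain d where d: "0 < d" "\<And>y. dist y x < d \<Longrightarrow> \<bar>Q y - Q x\<bar> < e"
      using near[OF e] by auto
    have "local_dim x \<le> hausdorff_dim (ball x d)"
      unfolding local_dim_def using d by (intro INF_lower) auto
    also have "\<dots> \<le> ennreal (Q x + e)"
      using Q_pos[of x] e d(2) by (intro hausdorff_dim_le) (force simp: dist_commute)+
    finally show "local_dim x \<le> ennreal (Q x) + ennreal e"
      using Q_pos[of x] e by simp
  qed
  show "ennreal (Q x) \<le> local_dim x"
    unfolding local_dim_def
  proof (rule INF_greatest)
    fix V assume "V \<in> {U. open U \<and> x \<in> U}"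
    then have V: "open V" "x \<in> V" by auto
    show "ennreal (Q x) \<le> hausdorff_dim V"
    proof (rule ennreal_le_epsilon)
      fix e :: real assume e: "0 < e"
      obtain d where d: "0 < d" "\<And>y. dist y x < d \<Longrightarrow> \<bar>Q y - Q x\<bar> < e"
        using near[OF e] by auto
      \<comment> \<open>\<open>Q x - e\<close> may be negative; the maximum with 0 lets
        \<open>ennreal\<close> distribute over the sum.\<close>
      have "ennreal (Q x) \<le> ennreal (max 0 (Q x - e) + e)"
        by (intro ennreal_leI) auto
      also have "\<dots> = ennreal (max 0 (Q x - e)) + ennreal e"
        using e by (intro ennreal_plus) auto
      also have "ennreal (max 0 (Q x - e)) \<le> hausdorff_dim V"
      proof (rule hausdorff_dim_ge)
        fix y assume "y \<in> V \<inter> ball x d"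
        then show "max 0 (Q x - e) \<le> Q y"
          using d(2)[of y] Q_pos[of y] by (auto simp: dist_commute)
      qed (use V d in auto)
      finally show "ennreal (Q x) \<le> hausdorff_dim V + ennreal e"
        by (simp add: add_right_mono)
    qed
  qed
qed

section \<open>The local gauge compared with powers of the diameter and with
  \<open>\<nu>\<close>\<close>

text \<open>At the scale of its own diameter, \<open>Q\<close> and hence the dimension of
  \<open>U\<close> stay below \<open>Q x - log (diameter U) K\<close>; this shift changes the power
  by the factor \<open>K\<close>. For diameter 0 the left side is 0.\<close>

lemma local_gauge_ge:
  assumes U: "bounded U" "x \<in> U" "diameter U \<le> D / 4" "diameter U < 1"
  shows "ennreal (diameter U powr Q x) \<le> ennreal K * local_gauge U"
proof (cases "diameter U = 0")
  case False
  let ?d = "diameter U"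
  let ?s = "Q x - log ?d K"
  have d: "0 < ?d"
    using False diameter_ge_0[OF U(1)] by simp
  have Q: "Q y \<le> ?s" if "y \<in> U" for y
    using that U d diameter_bounded_bound[of U x y] by (intro Q_compare) auto
  then have s: "0 \<le> ?s"
    using Q_pos[of x] U(2) by force
  have "ennreal (?d powr ?s) = diam_pow ?d (ennreal ?s)"
    using d s by (simp add: diam_pow_ennreal)
  also have "\<dots> \<le> diam_pow ?d (hausdorff_dim U)"
    using U d s Q by (intro diam_pow_antimono hausdorff_dim_le) auto
  also have "\<dots> = local_gauge U"
    using U by (auto simp: local_gauge_def)
  finally have "ennreal K * ennreal (?d powr ?s) \<le> ennreal K * local_gauge U"
    by (intro mult_left_mono) auto
  moreover have "K * ?d powr ?s = ?d powr Q x"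
    using U d K_gt_1 by (simp add: powr_minus_log)
  ultimately show ?thesis
    using K_gt_1 by (simp add: ennreal_mult[symmetric])
qed simp

text \<open>\<open>K\<close> absorbs the variation of \<open>Q\<close>, \<open>4 powr M\<close> the
  passage from \<open>2 * r\<close> to \<open>r / 2\<close>, and \<open>C\<close> the lower ball
  estimate.\<close>

definition "K' = K * 4 powr M * C"

text \<open>Balls are open, so their dimension is bounded below by the values of \<open>Q\<close> on
  them. The comparison of \<open>Q\<close> is made at scale \<open>2 * r\<close>, the same number
  that bounds the diameter.\<close>

lemma local_gauge_ball_le:
  assumes r: "0 < r" "2 * r \<le> D / 4" "2 * r < 1"
  shows "local_gauge (ball x r) \<le> ennreal K' * emeasure \<nu> (ball x (r / 2))"
proof -
  let ?s = "Q x + log (2 * r) K"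
  have "?s \<le> Q y" if "y \<in> ball x r" for y
    using that r Q_compare[of y x "2 * r"] by (simp add: dist_commute)
  \<comment> \<open>\<open>?s\<close> can be negative; as \<open>2 * r < 1\<close>, going back from
    \<open>max 0 ?s\<close> to \<open>?s\<close> can only enlarge the power.\<close>
  then have dim: "ennreal (max 0 ?s) \<le> hausdorff_dim (ball x r)"
    using r Q_pos by (intro hausdorff_dim_ge[of "ball x r" x]) (auto intro: less_imp_le)
  have "local_gauge (ball x r) \<le> diam_pow (2 * r) (hausdorff_dim (ball x r))"
    using bounded_diameter_ball[OF r(1), of x] r
    by (auto simp: local_gauge_def intro!: diam_pow_mono diameter_ge_0)
  also have "\<dots> \<le> diam_pow (2 * r) (ennreal (max 0 ?s))"
    using r dim by (intro diam_pow_antimono) auto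
  also have "\<dots> = ennreal ((2 * r) powr max 0 ?s)"
    using r by (intro diam_pow_ennreal) auto
  also have "(2 * r) powr max 0 ?s \<le> (2 * r) powr ?s"
    using r by (intro powr_mono') auto
  also have "\<dots> = K * (2 * r) powr Q x"
    using r K_gt_1 by (simp add: powr_minus_log)
  also have "(2 * r) powr Q x = 4 powr Q x * (r / 2) powr Q x"
    using r powr_mult[of 4 "r / 2" "Q x"] by simp
  also have "K * (4 powr Q x * (r / 2) powr Q x) \<le> K * (4 powr M * (r / 2) powr Q x)"
    using K_gt_1 Q_le[of x] by (intro mult_left_mono mult_right_mono powr_mono) auto
  also have "ennreal \<dots> = ennreal (K * 4 powr M) * ennreal ((r / 2) powr Q x)"
    using K_gt_1 by (simp add: ennreal_mult[symmetric] mult.assoc)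
  also have "\<dots> \<le> ennreal (K * 4 powr M) * (ennreal C * emeasure \<nu> (ball x (r / 2)))"
    using r by (intro mult_left_mono ball_lower) auto
  also have "\<dots> = ennreal K' * emeasure \<nu> (ball x (r / 2))"
    using C K_gt_1 by (simp add: K'_def ennreal_mult mult.assoc)
  finally show ?thesis by (simp add: ennreal_leI)
qed

section \<open>Comparison of \<open>\<nu>\<close> with \<open>H_loc\<close>\<close>

lemma nu_le_H_loc:
  assumes "E \<in> sets borel"
  shows "emeasure \<nu> E \<le> ennreal (C * 2 powr M * K) * emeasure H_loc E"
  unfolding emeasure_H_loc[OF assms]
proof (rule emeasure_le_outer_of[OF sets_nu])
  \<comment> \<open>The bound \<open>1 / 2\<close> keeps diameters strictly below 1, as
    \<open>local_gauge_ge\<close> requires.\<close>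
  show "0 < min (D / 4) (1 / 2)" using diam_pos by simp
  fix U :: "'a set" assume U: "bounded U" "diameter U \<le> min (D / 4) (1 / 2)" "U \<inter> E \<noteq> {}"
  then obtain x where x: "x \<in> U" by auto
  obtain W where W: "W \<in> sets borel" "U \<subseteq> W"
    "emeasure \<nu> W \<le> ennreal (C * 2 powr M * diameter U powr Q x)"
    using small_set_nu[of U x] U x by auto
  have "ennreal (C * 2 powr M * diameter U powr Q x)
      = ennreal (C * 2 powr M) * ennreal (diameter U powr Q x)"
    using C by (intro ennreal_mult) auto
  also have "\<dots> \<le> ennreal (C * 2 powr M) * (ennreal K * local_gauge U)"
    using U x by (intro mult_left_mono local_gauge_ge) auto
  also have "\<dots> = ennreal (C * 2 powr M * K) * local_gauge U"
    using C K_gt_1 by (simp add: ennreal_mult mult.assoc)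
  finally show "\<exists>W\<in>sets borel. U \<subseteq> W \<and> emeasure \<nu> W \<le> ennreal (C * 2 powr M * K) * local_gauge U"
    using W by (auto intro: order_trans)
qed (use C K_gt_1 in auto)

text \<open>The packed balls reach beyond \<open>F\<close> into \<open>?V n\<close>; for closed
  \<open>F\<close> the measures of these neighbourhoods tend to that of \<open>F\<close>, at each
  fixed \<open>\<delta>\<close>.\<close>

lemma H_loc_closed_le:
  assumes F: "closed F"
  shows "emeasure H_loc F \<le> ennreal K' * emeasure \<nu> F"
proof -
  let ?r = "\<lambda>n. inverse (real (Suc n))"
  let ?V = "\<lambda>n. \<Union>x\<in>F. ball x (?r n)"
  have "outer_delta local_gauge \<delta> F \<le> ennreal K' * emeasure \<nu> F" if "0 < \<delta>" for \<delta>
  proof (rule tendsto_lowerbound)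
    show "(\<lambda>n. ennreal K' * emeasure \<nu> (?V n)) \<longlonglongrightarrow> ennreal K' * emeasure \<nu> F"
      by (intro ennreal_tendsto_cmult Lim_emeasure_neighbourhoods finite_nu sets_nu F) auto
    \<comment> \<open>The three bounds give \<open>2 * ?r n\<close> at most \<open>\<delta>\<close>,
      at most \<open>D / 4\<close> and below 1.\<close>
    have "\<forall>\<^sub>F n in sequentially. ?r n < min (\<delta> / 2) (min (D / 8) (1 / 2))"
      using \<open>0 < \<delta>\<close> diam_pos by (intro order_tendstoD(2)[OF LIMSEQ_inverse_real_of_nat]) auto
    then show "\<forall>\<^sub>F n in sequentially. outer_delta local_gauge \<delta> F \<le> ennreal K' * emeasure \<nu> (?V n)"
    proof eventually_elim
      case (elim n)
      have r: "0 < ?r n" by simp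
      show ?case
      proof (rule outer_delta_le_emeasure[OF compact sets_nu _ r])
        show "2 * ?r n \<le> \<delta>" using elim by simp
        show "(\<Union>x\<in>F. ball x (?r n / 2)) \<subseteq> ?V n"
          using r by (intro UN_mono subset_ball) auto
        show "local_gauge (ball x (?r n)) \<le> ennreal K' * emeasure \<nu> (ball x (?r n / 2))" for x
          using elim by (intro local_gauge_ball_le) auto
        show "?V n \<in> sets borel"
          by (intro borel_open open_UN) auto
      qed
    qed
  qed simp
  then show ?thesis
    using F by (auto simp: emeasure_H_loc outer_of_def intro: SUP_least)
qed

text \<open>The closed case applied to the whole space makes \<open>H_loc\<close> finite, which is
  what its inner approximation by closed sets requires.\<close>

lemma H_loc_le:
  assumes E: "E \<in> sets borel"
  shows "emeasure H_loc E \<le> ennreal K' * emeasure \<nu> E"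
proof (rule ennreal_le_epsilon)
  interpret nu: finite_measure \<nu> by (rule finite_nu)
  have "space (H_loc :: 'a measure) = UNIV"
    using sets_H_loc by (metis sets_eq_imp_space_eq space_borel)
  moreover have "ennreal K' * emeasure \<nu> UNIV < \<infinity>"
    by (simp add: ennreal_mult_less_top nu.emeasure_eq_measure)
  then have "emeasure H_loc (UNIV :: 'a set) < \<infinity>"
    by (rule le_less_trans[OF H_loc_closed_le[OF closed_UNIV]])
  ultimately have fin: "finite_measure (H_loc :: 'a measure)"
    by (intro finite_measureI) simp
  interpret H: finite_measure "H_loc :: 'a measure" by (rule fin)
  fix e :: real assume e: "0 < e"
  obtain F V where FV: "closed F" "open V" "F \<subseteq> E" "E \<subseteq> V" "measure H_loc (V - F) < e"
    using closed_open_approximation[OF fin sets_H_loc E e] by blast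
  have "emeasure H_loc E \<le> emeasure H_loc (F \<union> (V - F))"
    using FV by (intro emeasure_mono) auto
  also have "\<dots> \<le> emeasure H_loc F + emeasure H_loc (V - F)"
    using FV by (intro emeasure_subadditive) auto
  also have "\<dots> \<le> ennreal K' * emeasure \<nu> F + ennreal e"
    using FV by (intro add_mono H_loc_closed_le) (auto simp: H.emeasure_eq_measure ennreal_leI)
  also have "emeasure \<nu> F \<le> emeasure \<nu> E"
    using FV E sets_nu by (intro emeasure_mono) auto
  finally show "emeasure H_loc E \<le> ennreal K' * emeasure \<nu> E + ennreal e"
    by (simp add: add_right_mono mult_left_mono)
qed

lemma strongly_equivalent_H_loc: "\<nu> \<asymp> H_loc"
proof -
  let ?c = "C * 2 powr M * K" and ?k = "max (C * 2 powr M * K) K'"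
  have pos: "0 < ?c" "0 < K'"
    using C K_gt_1 by (auto simp: K'_def)
  have "ennreal (1 / ?k) * emeasure H_loc E \<le> emeasure \<nu> E \<and>
      emeasure \<nu> E \<le> ennreal ?k * emeasure H_loc E" if E: "E \<in> sets borel" for E
  proof
    have "ennreal (1 / ?k) * emeasure H_loc E \<le> ennreal (1 / K') * (ennreal K' * emeasure \<nu> E)"
      using pos by (intro mult_mono H_loc_le E ennreal_leI divide_left_mono) auto
    also have "\<dots> = emeasure \<nu> E"
      using pos by (simp add: mult.assoc[symmetric] ennreal_mult[symmetric])
    finally show "ennreal (1 / ?k) * emeasure H_loc E \<le> emeasure \<nu> E" .
    have "emeasure \<nu> E \<le> ennreal ?c * emeasure H_loc E"
      by (rule nu_le_H_loc[OF E])
    also have "\<dots> \<le> ennreal ?k * emeasure H_loc E"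
      by (intro mult_right_mono ennreal_leI) auto
    finally show "emeasure \<nu> E \<le> ennreal ?k * emeasure H_loc E" .
  qed
  then show ?thesis
    unfolding strongly_equivalent_def using pos by (intro exI[of _ ?k]) auto
qed

end

theorem theorem3p2p8:
  fixes Q :: "'a::metric_space \<Rightarrow> real" and \<nu> :: "'a measure"
  assumes "compact (UNIV :: 'a set)"
    and "\<exists>x y :: 'a. x \<noteq> y"
    and "\<And>x. 0 < Q x"
    and "bounded (range Q)"
    and "sets \<nu> = sets borel"
    and "ahlfors_regular Q \<nu>"
  shows "(\<forall>x. ennreal (Q x) = local_dim x) \<and> \<nu> \<asymp> H_loc"
proof -
  obtain C where C: "1 < C" and regular: "\<And>x r. 0 < r \<Longrightarrow> r \<le> diameter (UNIV :: 'a set) / 2 \<Longrightarrow>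
        ennreal (1 / C) * emeasure \<nu> (ball x r) \<le> ennreal (r powr Q x) \<and>
        ennreal (r powr Q x) \<le> ennreal C * emeasure \<nu> (ball x r)"
    using assms(6) unfolding ahlfors_regular_def by blast
  obtain M where M: "\<And>x. Q x \<le> M"
    using assms(4) by (auto simp: bounded_iff abs_le_iff)
  obtain x y :: 'a where "x \<noteq> y"
    using assms(2) by blast
  then have diam: "0 < diameter (UNIV :: 'a set)"
    using diameter_bounded_bound[OF compact_imp_bounded[OF assms(1)], of x y]
    by (metis UNIV_I less_le_trans zero_less_dist_iff)
  \<comment> \<open>The factor \<open>1 / C\<close> is moved to the other side to match the form of
    \<open>ball_upper\<close>.\<close>
  have upper: "emeasure \<nu> (ball x r) \<le> ennreal (C * r powr Q x)"
    if "0 < r" "r \<le> diameter (UNIV :: 'a set) / 2" for x r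
  proof -
    have "emeasure \<nu> (ball x r) = ennreal C * (ennreal (1 / C) * emeasure \<nu> (ball x r))"
      using C by (simp add: mult.assoc[symmetric] ennreal_mult[symmetric])
    also have "\<dots> \<le> ennreal C * ennreal (r powr Q x)"
      using regular[OF that] by (intro mult_left_mono) auto
    finally show ?thesis
      using C by (simp add: ennreal_mult)
  qed
  interpret ahlfors_space Q \<nu> C M "diameter (UNIV :: 'a set)"
    by unfold_locales (use assms C M diam upper regular in auto)
  show ?thesis
    using local_dim_eq strongly_equivalent_H_loc by simp
qed

end
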